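(* For all $i,j,k,l\in\{1,\dots,D\}$, writing $f$ for the random variable $f(z^*,z^* )$, $$\operatorname{Cov}(g_i,f)=0,\quad \operatorname{Cov}(H^{(1,1)}_{i,j},f)=0,\quad \operatorname{Cov}(H^{(1,2)}_{i,j},f)=0,$$ $$\operatorname{Cov}(H^{(1,1)}_{i,j},g_k)=0,\quad \operatorname{Cov}(H^{(1,2)}_{i,j},g_k)=0,\quad \operatorname{Cov}(H^{(1,2)}_{i,j},H^{(1,1)}_{k,l})=0.$$
   Context: Let $D\ge 1$ and write points of $\mathbb{R}^D\times\mathbb{R}^D$ as $x=(x^{(1)},x^{(2)})$, with $x^{flip}=(x^{(2)},x^{(1)})$. A real-valued random field is Gaussian if every finite linear combination of its values is a (possibly degenerate) Gaussian random variable. Let $u$ be a mean-zero isotropic Gaussian field on $\mathbb{R}^D\times\mathbb{R}^D$ with covariance function $k_u(x,y)=h(\|x-y\|_2^2)$, where $h:[0,\infty)\to\mathbb{R}$. The field $f(x)=u(x)-u(x^{flip})$ is called a block isotropic Gaussian field with base field $u$; its covariance function is denoted $k_f$. Standing smoothness assumption: $k_u$ (hence $k_f$) is four times continuously differentiable, and $h$ is twice continuously differentiable on $[0,\infty)$. Derivatives of $f$ are taken in the mean-square ($L^2(\Omega)$) sense. Fix $z^*\in\mathbb{R}^D$ and $z=(z^*,z^* )$. Define the random vector $g\in\mathbb{R}^D$ and random matrices $H^{(1,1)},H^{(1,2)}\in\mathbb{R}^{D\times D}$ by $$g_i=\partial_{x^{(1)}_i}f(x)\big|_{x=z},\quad H^{(1,1)}_{i,j}=\partial_{x^{(1)}_i}\partial_{x^{(1)}_j}f(x)\big|_{x=z},\quad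 H^{(1,2)}_{i,j}=\partial_{x^{(1)}_i}\partial_{x^{(2)}_j}f(x)\big|_{x=z}.$$ *)

theory Defs
  imports "HOL-Probability.Probability"
begin

definition covar :: "'w measure \<Rightarrow> ('w \<Rightarrow> real) \<Rightarrow> ('w \<Rightarrow> real) \<Rightarrow> real" where
  "covar M X Y =
    (\<integral>\<omega>. (X \<omega> - (\<integral>\<omega>'. X \<omega>' \<partial>M)) * (Y \<omega> - (\<integral>\<omega>'. Y \<omega>' \<partial>M)) \<partial>M)"

text \<open>The second disjunct is the degenerate case of variance zero.\<close>

definition gaussian_rv :: "'w measure \<Rightarrow> ('w \<Rightarrow> real) \<Rightarrow> bool" where
  "gaussian_rv M X \<longleftrightarrow> X \<in> borel_measurable M \<and>
    ((\<exists>\<mu> \<sigma>. \<sigma> > 0 \<and> distributed M lborel X (normal_density \<mu> \<sigma>)) \<or>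
     (\<exists>\<mu>. AE \<omega> in M. X \<omega> = \<mu>))"

definition gaussian_field :: "'w measure \<Rightarrow> ('p \<Rightarrow> 'w \<Rightarrow> real) \<Rightarrow> bool" where
  "gaussian_field M u \<longleftrightarrow>
    (\<forall>S c. finite S \<longrightarrow> gaussian_rv M (\<lambda>\<omega>. \<Sum>x\<in>S. c x * u x \<omega>))"

text \<open>Only the values of \<^term>\<open>h\<close> on the half-line matter below; the covariance \<^term>\<open>covar M (u x) (u y)\<close>
  is that of the mean-zero variables \<^term>\<open>u x\<close> and \<^term>\<open>u y\<close>.\<close>

definition isotropic_gaussian_field ::
    "'w measure \<Rightarrow> (real \<Rightarrow> real) \<Rightarrow> ('p::real_normed_vector \<Rightarrow> 'w \<Rightarrow> real) \<Rightarrow> bool" where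
  "isotropic_gaussian_field M h u \<longleftrightarrow>
    gaussian_field M u \<and>
    (\<forall>x. (\<integral>\<omega>. u x \<omega> \<partial>M) = 0) \<and>
    (\<forall>x y. covar M (u x) (u y) = h ((norm (x - y))\<^sup>2))"

definition block_field :: "('a \<times> 'a \<Rightarrow> 'w \<Rightarrow> real) \<Rightarrow> 'a \<times> 'a \<Rightarrow> 'w \<Rightarrow> real" where
  "block_field u x \<omega> = u x \<omega> - u (prod.swap x) \<omega>"

primrec cont_diff :: "nat \<Rightarrow> ('a::euclidean_space \<Rightarrow> real) \<Rightarrow> bool" where
  "cont_diff 0 F \<longleftrightarrow> continuous_on UNIV F"
| "cont_diff (Suc k) F \<longleftrightarrow> (\<forall>x. F differentiable (at x)) \<and>
     (\<forall>b\<in>Basis. cont_diff k (\<lambda>x. frechet_derivative F (at x) b))"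

text \<open>Derivatives at the endpoint 0 are one-sided.\<close>

definition C2_halfline :: "(real \<Rightarrow> real) \<Rightarrow> bool" where
  "C2_halfline h \<longleftrightarrow> (\<exists>h' h''.
     (\<forall>r\<ge>0. (h has_real_derivative h' r) (at r within {0..})) \<and>
     (\<forall>r\<ge>0. (h' has_real_derivative h'' r) (at r within {0..})) \<and>
     continuous_on {0..} h'')"

definition square_integrable :: "'w measure \<Rightarrow> ('w \<Rightarrow> real) \<Rightarrow> bool" where
  "square_integrable M X \<longleftrightarrow> X \<in> borel_measurable M \<and> integrable M (\<lambda>\<omega>. (X \<omega>)\<^sup>2)"

text \<open>\<open>Y\<close> is the mean-square derivative at \<open>x\<close> of the second-order field \<open>F\<close> in direction \<open>b\<close>.
  Square integrability of \<open>F\<close> and \<open>Y\<close> is required explicitly because the Bochner integral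
  of a non-integrable function is 0.\<close>

definition has_ms_derivative ::
    "'w measure \<Rightarrow> ('p::real_vector \<Rightarrow> 'w \<Rightarrow> real) \<Rightarrow> 'p \<Rightarrow> 'p \<Rightarrow> ('w \<Rightarrow> real) \<Rightarrow> bool" where
  "has_ms_derivative M F b x Y \<longleftrightarrow>
    (\<forall>y. square_integrable M (F y)) \<and> square_integrable M Y \<and>
    ((\<lambda>t. \<integral>\<omega>. ((F (x + t *\<^sub>R b) \<omega> - F x \<omega>) / t - Y \<omega>)\<^sup>2 \<partial>M) \<longlongrightarrow> 0) (at 0)"

text \<open>A mean-square derivative is an element of \<open>L\<^sup>2\<close>, i.e. unique up to almost-sure equality
  (lemma \<open>has_ms_derivative_unique\<close>); the choice operator selects one representative.
  The result is again a field, so that the operator can be iterated.\<close>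

definition ms_derivative ::
    "'w measure \<Rightarrow> 'p::real_vector \<Rightarrow> ('p \<Rightarrow> 'w \<Rightarrow> real) \<Rightarrow> 'p \<Rightarrow> 'w \<Rightarrow> real" where
  "ms_derivative M b F x = (SOME Y. has_ms_derivative M F b x Y)"

lemma square_integrable_diff:
  assumes "square_integrable M X" "square_integrable M Y"
  shows "square_integrable M (\<lambda>\<omega>. X \<omega> - Y \<omega>)"
proof -
  have [measurable]: "X \<in> borel_measurable M" "Y \<in> borel_measurable M"
    using assms by (auto simp: square_integrable_def)
  have le: "(a - b)\<^sup>2 \<le> 2 * a\<^sup>2 + 2 * b\<^sup>2" for a b :: real
    using zero_le_power2[of "a + b"] by (simp add: power2_eq_square algebra_simps)
  have "integrable M (\<lambda>\<omega>. 2 * (X \<omega>)\<^sup>2 + 2 * (Y \<omega>)\<^sup>2)"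
    using assms by (auto simp: square_integrable_def)
  then have "integrable M (\<lambda>\<omega>. (X \<omega> - Y \<omega>)\<^sup>2)"
    by (rule Bochner_Integration.integrable_bound) (use le in auto)
  then show ?thesis by (simp add: square_integrable_def)
qed

lemma has_ms_derivative_unique:
  assumes Y: "has_ms_derivative M F b x Y" and Z: "has_ms_derivative M F b x Z"
  shows "AE \<omega> in M. Y \<omega> = Z \<omega>"
proof -
  define q where "q t \<omega> = (F (x + t *\<^sub>R b) \<omega> - F x \<omega>) / t" for t \<omega>
  have sq: "square_integrable M (q t)" for t
    using square_integrable_diff[of M "F (x + t *\<^sub>R b)" "F x"] Y
    by (auto simp: has_ms_derivative_def square_integrable_def q_def[abs_def] power_divide)
  have sY: "square_integrable M Y" and sZ: "square_integrable M Z"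
    using Y Z by (auto simp: has_ms_derivative_def)
  note int = square_integrable_diff[OF sq sY] square_integrable_diff[OF sq sZ]
    square_integrable_diff[OF sY sZ]
  have le: "(c - d)\<^sup>2 \<le> 2 * (a - c)\<^sup>2 + 2 * (a - d)\<^sup>2" for a c d :: real
    using zero_le_power2[of "(a - c) + (a - d)"] by (simp add: power2_eq_square algebra_simps)
  have "(\<integral>\<omega>. (Y \<omega> - Z \<omega>)\<^sup>2 \<partial>M)
      \<le> (\<integral>\<omega>. 2 * (q t \<omega> - Y \<omega>)\<^sup>2 + 2 * (q t \<omega> - Z \<omega>)\<^sup>2 \<partial>M)" for t
    by (rule integral_mono) (use int le in \<open>auto simp: square_integrable_def\<close>)
  also have "\<dots> t = 2 * (\<integral>\<omega>. (q t \<omega> - Y \<omega>)\<^sup>2 \<partial>M) + 2 * (\<integral>\<omega>. (q t \<omega> - Z \<omega>)\<^sup>2 \<partial>M)" for t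
    using int by (simp add: square_integrable_def)
  finally have b: "(\<integral>\<omega>. (Y \<omega> - Z \<omega>)\<^sup>2 \<partial>M)
      \<le> 2 * (\<integral>\<omega>. (q t \<omega> - Y \<omega>)\<^sup>2 \<partial>M) + 2 * (\<integral>\<omega>. (q t \<omega> - Z \<omega>)\<^sup>2 \<partial>M)" for t .
  have "((\<lambda>t. 2 * (\<integral>\<omega>. (q t \<omega> - Y \<omega>)\<^sup>2 \<partial>M) + 2 * (\<integral>\<omega>. (q t \<omega> - Z \<omega>)\<^sup>2 \<partial>M))
      \<longlongrightarrow> 2 * 0 + 2 * 0) (at 0)"
    using Y Z unfolding has_ms_derivative_def q_def by (intro tendsto_intros) auto
  then have "(\<integral>\<omega>. (Y \<omega> - Z \<omega>)\<^sup>2 \<partial>M) \<le> 2 * 0 + 2 * 0"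
    by (rule tendsto_lowerbound) (use b in auto)
  then have "(\<integral>\<omega>. (Y \<omega> - Z \<omega>)\<^sup>2 \<partial>M) = 0"
    by (simp add: order.antisym)
  then have "AE \<omega> in M. (Y \<omega> - Z \<omega>)\<^sup>2 = 0"
    using int(3) by (subst (asm) integral_nonneg_eq_0_iff_AE) (auto simp: square_integrable_def)
  then show ?thesis by simp
qed

abbreviation dir1 :: "'n \<Rightarrow> (real ^ 'n) \<times> (real ^ 'n)" where
  "dir1 i \<equiv> (axis i 1, 0)"

abbreviation dir2 :: "'n \<Rightarrow> (real ^ 'n) \<times> (real ^ 'n)" where
  "dir2 i \<equiv> (0, axis i 1)"

definition grad1 ::
    "'w measure \<Rightarrow> ((real ^ 'n) \<times> (real ^ 'n) \<Rightarrow> 'w \<Rightarrow> real) \<Rightarrow> (real ^ 'n) \<times> (real ^ 'n)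
      \<Rightarrow> 'n \<Rightarrow> 'w \<Rightarrow> real" where
  "grad1 M f x i = ms_derivative M (dir1 i) f x"

definition hess11 ::
    "'w measure \<Rightarrow> ((real ^ 'n) \<times> (real ^ 'n) \<Rightarrow> 'w \<Rightarrow> real) \<Rightarrow> (real ^ 'n) \<times> (real ^ 'n)
      \<Rightarrow> 'n \<Rightarrow> 'n \<Rightarrow> 'w \<Rightarrow> real" where
  "hess11 M f x i j = ms_derivative M (dir1 i) (ms_derivative M (dir1 j) f) x"

definition hess12 ::
    "'w measure \<Rightarrow> ((real ^ 'n) \<times> (real ^ 'n) \<Rightarrow> 'w \<Rightarrow> real) \<Rightarrow> (real ^ 'n) \<times> (real ^ 'n)
      \<Rightarrow> 'n \<Rightarrow> 'n \<Rightarrow> 'w \<Rightarrow> real" where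
  "hess12 M f x i j = ms_derivative M (dir1 i) (ms_derivative M (dir2 j) f) x"

end

theory Submission
  imports Defs
begin

text \<open>The centre \<open>z\<close> is a fixed point of the flip, so \<open>f z\<close> vanishes identically and the first three
  covariances are trivial. The other three hold by symmetry. The covariance of the base field \<open>u\<close>
  depends only on distances, so it is unchanged when both arguments are moved by an isometry that
  fixes \<open>z\<close>. If the isometry acts on the directions of differentiation by signs, then each
  mean-square derivative contributes one such sign to the covariance of derivatives of \<open>u\<close>; at the
  fixed point \<open>z\<close> a total sign of \<open>-1\<close> leaves a covariance that equals its own negative.
  \<^item> The point reflection in \<open>z\<close> gives every direction the sign \<open>-1\<close>, and a second and a first
    derivative together contain three of them.
  \<^item> The reflection of the second block alone gives \<open>+1\<close> to directions in the first block
    and \<open>-1\<close> to those in the second. A mixed derivative contains one direction of the second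
    block and a pure one none or two, hence both together an odd number.

  Both arguments pass to \<open>f\<close>, because each derivative of \<open>f\<close> at \<open>z\<close> is almost surely the
  corresponding derivative of \<open>u\<close> minus the one in the flipped directions
  (\<open>has_ms_derivative_block_field\<close>, \<open>has_ms_derivative_block_field_iterated\<close>), and flipping
  changes neither the order of a derivative nor whether it is mixed or pure.

  What needs analysis is that these mean-square derivatives exist at all: the derivative operator
  is a choice operator, and a choice from the empty set would say nothing. Existence follows from
  the smoothness of the covariance (\<open>cont_diff_covariance_imp_ms_derivative\<close>). The inner product of
  two difference quotients in the same direction is a mixed second difference quotient of the
  covariance, which converges; hence the difference quotients are Cauchy in \<open>L\<^sup>2\<close>, and \<open>L\<^sup>2\<close> is
  complete (\<open>L2_complete\<close>). The derivative field has as its covariance a mixed second derivative of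
  the original one, which is still twice continuously differentiable, so the argument applies a
  second time.\<close>

section \<open>Square-integrable random variables\<close>

definition L2_inner :: "'w measure \<Rightarrow> ('w \<Rightarrow> real) \<Rightarrow> ('w \<Rightarrow> real) \<Rightarrow> real" where
  "L2_inner M X Y = (\<integral>\<omega>. X \<omega> * Y \<omega> \<partial>M)"

lemma L2_inner_commute: "L2_inner M X Y = L2_inner M Y X"
  by (simp add: L2_inner_def mult.commute)

lemma square_integrable_measurable: "square_integrable M X \<Longrightarrow> X \<in> borel_measurable M"
  by (simp add: square_integrable_def)

lemma square_integrable_cmult:
  "square_integrable M X \<Longrightarrow> square_integrable M (\<lambda>\<omega>. c * X \<omega>)"
  by (auto simp: square_integrable_def power_mult_distrib)

lemma (in finite_measure) square_integrable_const: "square_integrable M (\<lambda>_. c)"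
  by (simp add: square_integrable_def)

lemma integrable_mult_square_integrable:
  assumes X: "square_integrable M X" and Y: "square_integrable M Y"
  shows "integrable M (\<lambda>\<omega>. X \<omega> * Y \<omega>)"
proof (rule Bochner_Integration.integrable_bound)
  show "integrable M (\<lambda>\<omega>. (X \<omega>)\<^sup>2 + (Y \<omega>)\<^sup>2)"
    using X Y by (auto simp: square_integrable_def)
  show "(\<lambda>\<omega>. X \<omega> * Y \<omega>) \<in> borel_measurable M"
    using X Y by (auto simp: square_integrable_def)
  have "\<bar>a * b\<bar> \<le> a\<^sup>2 + b\<^sup>2" for a b :: real
  proof -
    have "2 * (\<bar>a\<bar> * \<bar>b\<bar>) \<le> a\<^sup>2 + b\<^sup>2" "0 \<le> \<bar>a\<bar> * \<bar>b\<bar>"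
      using sum_squares_bound[of "\<bar>a\<bar>" "\<bar>b\<bar>"] by auto
    then show ?thesis unfolding abs_mult by linarith
  qed
  then show "AE \<omega> in M. norm (X \<omega> * Y \<omega>) \<le> norm ((X \<omega>)\<^sup>2 + (Y \<omega>)\<^sup>2)"
    by auto
qed

lemma (in finite_measure) square_integrable_imp_integrable:
  "square_integrable M X \<Longrightarrow> integrable M X"
  using integrable_mult_square_integrable[OF _ square_integrable_const, of X 1] by simp

lemma L2_inner_diff_left:
  assumes "square_integrable M X" "square_integrable M Y" "square_integrable M Z"
  shows "L2_inner M (\<lambda>\<omega>. X \<omega> - Y \<omega>) Z = L2_inner M X Z - L2_inner M Y Z"
  using assms by (simp add: L2_inner_def left_diff_distrib integrable_mult_square_integrable)

lemma L2_inner_diff_right: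
  assumes "square_integrable M X" "square_integrable M Y" "square_integrable M Z"
  shows "L2_inner M Z (\<lambda>\<omega>. X \<omega> - Y \<omega>) = L2_inner M Z X - L2_inner M Z Y"
  using L2_inner_diff_left[OF assms] by (simp add: L2_inner_commute)

lemma L2_inner_cmult_left: "L2_inner M (\<lambda>\<omega>. c * X \<omega>) Y = c * L2_inner M X Y"
  by (simp add: L2_inner_def mult.assoc)

lemma L2_inner_cmult_right: "L2_inner M X (\<lambda>\<omega>. c * Y \<omega>) = c * L2_inner M X Y"
  by (simp add: L2_inner_def mult.left_commute)

lemma L2_inner_self: "L2_inner M X X = (\<integral>\<omega>. (X \<omega>)\<^sup>2 \<partial>M)"
  by (simp add: L2_inner_def power2_eq_square)

lemma L2_inner_diff_self:
  assumes "square_integrable M X" "square_integrable M Y"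
  shows "(\<integral>\<omega>. (X \<omega> - Y \<omega>)\<^sup>2 \<partial>M) = L2_inner M X X - 2 * L2_inner M X Y + L2_inner M Y Y"
  using assms
  by (simp flip: L2_inner_self add: L2_inner_diff_left L2_inner_diff_right square_integrable_diff
      L2_inner_commute[of M Y X])

lemma integral_square_diff_le:
  assumes X: "square_integrable M X" and Y: "square_integrable M Y"
  shows "(\<integral>\<omega>. (X \<omega> - Y \<omega>)\<^sup>2 \<partial>M) \<le> 2 * (\<integral>\<omega>. (X \<omega>)\<^sup>2 \<partial>M) + 2 * (\<integral>\<omega>. (Y \<omega>)\<^sup>2 \<partial>M)"
proof -
  have le: "(a - b)\<^sup>2 \<le> 2 * a\<^sup>2 + 2 * b\<^sup>2" for a b :: real
    using zero_le_power2[of "a + b"] by (simp add: power2_eq_square algebra_simps)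
  have "(\<integral>\<omega>. (X \<omega> - Y \<omega>)\<^sup>2 \<partial>M) \<le> (\<integral>\<omega>. 2 * (X \<omega>)\<^sup>2 + 2 * (Y \<omega>)\<^sup>2 \<partial>M)"
    by (rule integral_mono)
      (use X Y square_integrable_diff[OF X Y] le in \<open>auto simp: square_integrable_def\<close>)
  also have "\<dots> = 2 * (\<integral>\<omega>. (X \<omega>)\<^sup>2 \<partial>M) + 2 * (\<integral>\<omega>. (Y \<omega>)\<^sup>2 \<partial>M)"
    using X Y by (simp add: square_integrable_def)
  finally show ?thesis .
qed

text \<open>The quadratic polynomial \<open>c \<mapsto> \<parallel>X - c Y\<parallel>\<^sup>2\<close> is nonnegative; its minimum gives the inequality.\<close>

lemma L2_inner_Cauchy_Schwarz:
  assumes X: "square_integrable M X" and Y: "square_integrable M Y"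
  shows "(L2_inner M X Y)\<^sup>2 \<le> L2_inner M X X * L2_inner M Y Y"
proof -
  have q: "0 \<le> L2_inner M X X - 2 * c * L2_inner M X Y + c\<^sup>2 * L2_inner M Y Y" for c
  proof -
    have "0 \<le> (\<integral>\<omega>. (X \<omega> - c * Y \<omega>)\<^sup>2 \<partial>M)" by simp
    also have "\<dots> = L2_inner M X X - 2 * c * L2_inner M X Y + c\<^sup>2 * L2_inner M Y Y"
      unfolding L2_inner_diff_self[OF X square_integrable_cmult[OF Y, of c]]
        L2_inner_cmult_left L2_inner_cmult_right by (simp add: power2_eq_square)
    finally show ?thesis .
  qed
  show ?thesis
  proof (cases "L2_inner M Y Y = 0")
    case True
    have "AE \<omega> in M. (Y \<omega>)\<^sup>2 = 0"
      using True Y unfolding L2_inner_self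
      by (subst (asm) integral_nonneg_eq_0_iff_AE) (auto simp: square_integrable_def)
    then have "AE \<omega> in M. X \<omega> * Y \<omega> = 0" by auto
    then have "L2_inner M X Y = 0"
      unfolding L2_inner_def by (rule integral_eq_zero_AE)
    then show ?thesis using True by simp
  next
    case False
    then have "L2_inner M Y Y > 0"
      by (simp add: L2_inner_self order.not_eq_order_implies_strict)
    then show ?thesis
      using q[of "L2_inner M X Y / L2_inner M Y Y"] by (simp add: field_simps power2_eq_square)
  qed
qed

lemma tendsto_L2_inner:
  assumes X: "\<And>t. square_integrable M (X t)" and Y: "square_integrable M Y"
    and Z: "square_integrable M Z"
    and lim: "((\<lambda>t. \<integral>\<omega>. (X t \<omega> - Y \<omega>)\<^sup>2 \<partial>M) \<longlongrightarrow> 0) F"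
  shows "((\<lambda>t. L2_inner M (X t) Z) \<longlongrightarrow> L2_inner M Y Z) F"
proof -
  have "((\<lambda>t. (\<integral>\<omega>. (X t \<omega> - Y \<omega>)\<^sup>2 \<partial>M) * L2_inner M Z Z) \<longlongrightarrow> 0 * L2_inner M Z Z) F"
    by (intro tendsto_intros lim)
  then have lim0: "((\<lambda>t. (\<integral>\<omega>. (X t \<omega> - Y \<omega>)\<^sup>2 \<partial>M) * L2_inner M Z Z) \<longlongrightarrow> 0) F"
    by simp
  have le: "(L2_inner M (X t) Z - L2_inner M Y Z)\<^sup>2
      \<le> (\<integral>\<omega>. (X t \<omega> - Y \<omega>)\<^sup>2 \<partial>M) * L2_inner M Z Z" for t
    using L2_inner_Cauchy_Schwarz[OF square_integrable_diff[OF X Y] Z]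
    by (simp add: L2_inner_diff_left X Y Z flip: L2_inner_self)
  have "((\<lambda>t. (L2_inner M (X t) Z - L2_inner M Y Z)\<^sup>2) \<longlongrightarrow> 0) F"
    by (rule Lim_null_comparison[OF always_eventually lim0]) (simp add: le)
  from tendsto_real_sqrt[OF this]
  have "((\<lambda>t. L2_inner M (X t) Z - L2_inner M Y Z) \<longlongrightarrow> 0) F"
    by (simp add: tendsto_rabs_zero_iff)
  then show ?thesis by (rule LIM_zero_cancel)
qed

text \<open>On a probability space an \<open>L\<^sup>2\<close>-Cauchy sequence is Cauchy in \<open>L\<^sup>1\<close>, so a subsequence converges almost
  surely; Fatou's lemma along this subsequence turns the Cauchy bounds into bounds on the distance
  to the limit.\<close>

lemma (in prob_space) L2_complete:
  fixes X :: "nat \<Rightarrow> 'a \<Rightarrow> real"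
  assumes X: "\<And>n. square_integrable M (X n)"
    and Cauchy: "\<And>e. e > 0 \<Longrightarrow>
      \<exists>N. \<forall>m\<ge>N. \<forall>n\<ge>N. (\<integral>\<omega>. (X m \<omega> - X n \<omega>)\<^sup>2 \<partial>M) < e"
  obtains Y where "square_integrable M Y" "(\<lambda>n. \<integral>\<omega>. (X n \<omega> - Y \<omega>)\<^sup>2 \<partial>M) \<longlonglongrightarrow> 0"
proof -
  note [measurable] = square_integrable_measurable[OF X]
  have XX: "square_integrable M (\<lambda>\<omega>. X m \<omega> - X n \<omega>)" for m n
    by (intro square_integrable_diff X)
  have L1: "(\<integral>\<omega>. norm (X m \<omega> - X n \<omega>) \<partial>M)\<^sup>2 \<le> (\<integral>\<omega>. (X m \<omega> - X n \<omega>)\<^sup>2 \<partial>M)" for m n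
  proof -
    have "square_integrable M (\<lambda>\<omega>. norm (X m \<omega> - X n \<omega>))"
      using XX[of m n] by (simp add: square_integrable_def)
    from L2_inner_Cauchy_Schwarz[OF this square_integrable_const[of 1]] show ?thesis
      by (simp add: L2_inner_self) (simp add: L2_inner_def prob_space)
  qed
  have "\<exists>N. \<forall>m\<ge>N. \<forall>n\<ge>N. (\<integral>\<omega>. norm (X m \<omega> - X n \<omega>) \<partial>M) < e" if e: "e > 0" for e
  proof -
    from e obtain N where N: "\<forall>m\<ge>N. \<forall>n\<ge>N. (\<integral>\<omega>. (X m \<omega> - X n \<omega>)\<^sup>2 \<partial>M) < e\<^sup>2"
      using Cauchy[of "e\<^sup>2"] by auto
    have "(\<integral>\<omega>. norm (X m \<omega> - X n \<omega>) \<partial>M) < e" if "m \<ge> N" "n \<ge> N" for m n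
    proof (rule power_less_imp_less_base)
      show "(\<integral>\<omega>. norm (X m \<omega> - X n \<omega>) \<partial>M)\<^sup>2 < e\<^sup>2"
        using L1[of m n] N that by (meson order.strict_trans1)
    qed (use e in simp)
    then show ?thesis by blast
  qed
  then obtain r where r: "strict_mono r" and AEC: "AE \<omega> in M. Cauchy (\<lambda>i. X (r i) \<omega>)"
    using cauchy_L1_AE_cauchy_subseq[of M X] square_integrable_imp_integrable[OF X] by metis
  define Y where "Y \<omega> = lim (\<lambda>i. X (r i) \<omega>)" for \<omega>
  have Ym[measurable]: "Y \<in> borel_measurable M"
    unfolding Y_def[abs_def] by measurable
  have AElim: "AE \<omega> in M. (\<lambda>i. X (r i) \<omega>) \<longlonglongrightarrow> Y \<omega>"
    using AEC by eventually_elim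
      (simp add: Y_def Cauchy_convergent_iff convergent_LIMSEQ_iff)
  have bound: "integrable M (\<lambda>\<omega>. (X m \<omega> - Y \<omega>)\<^sup>2) \<and> (\<integral>\<omega>. (X m \<omega> - Y \<omega>)\<^sup>2 \<partial>M) \<le> e"
    if e: "e > 0" and N: "\<forall>m\<ge>N. \<forall>n\<ge>N. (\<integral>\<omega>. (X m \<omega> - X n \<omega>)\<^sup>2 \<partial>M) < e" and m: "m \<ge> N"
    for e m N
  proof -
    have "(\<integral>\<^sup>+\<omega>. ennreal ((X m \<omega> - Y \<omega>)\<^sup>2) \<partial>M)
        = (\<integral>\<^sup>+\<omega>. liminf (\<lambda>i. ennreal ((X m \<omega> - X (r i) \<omega>)\<^sup>2)) \<partial>M)"
    proof (rule nn_integral_cong_AE, use AElim in eventually_elim)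
      fix \<omega> assume "(\<lambda>i. X (r i) \<omega>) \<longlonglongrightarrow> Y \<omega>"
      then have "(\<lambda>i. ennreal ((X m \<omega> - X (r i) \<omega>)\<^sup>2)) \<longlonglongrightarrow> ennreal ((X m \<omega> - Y \<omega>)\<^sup>2)"
        by (intro tendsto_ennrealI tendsto_intros)
      from lim_imp_Liminf[OF sequentially_bot this]
      show "ennreal ((X m \<omega> - Y \<omega>)\<^sup>2) = liminf (\<lambda>i. ennreal ((X m \<omega> - X (r i) \<omega>)\<^sup>2))"
        by (rule sym)
    qed
    also have "\<dots> \<le> liminf (\<lambda>i. \<integral>\<^sup>+\<omega>. ennreal ((X m \<omega> - X (r i) \<omega>)\<^sup>2) \<partial>M)"
      by (rule nn_integral_liminf) simp
    also have "\<dots> \<le> liminf (\<lambda>i. ennreal e)"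
    proof (rule Liminf_mono, rule eventually_sequentiallyI)
      fix i assume "N \<le> i"
      then have "r i \<ge> N" using seq_suble[OF r, of i] by simp
      then have "(\<integral>\<omega>. (X m \<omega> - X (r i) \<omega>)\<^sup>2 \<partial>M) \<le> e" using N m by (simp add: less_imp_le)
      then show "(\<integral>\<^sup>+\<omega>. ennreal ((X m \<omega> - X (r i) \<omega>)\<^sup>2) \<partial>M) \<le> ennreal e"
        using XX[of m "r i"] e
        by (subst nn_integral_eq_integral) (auto simp: square_integrable_def)
    qed
    also have "\<dots> = ennreal e" by (simp add: Liminf_const)
    finally have le: "(\<integral>\<^sup>+\<omega>. ennreal ((X m \<omega> - Y \<omega>)\<^sup>2) \<partial>M) \<le> ennreal e" .
    then have int: "integrable M (\<lambda>\<omega>. (X m \<omega> - Y \<omega>)\<^sup>2)"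
      by (intro integrableI_nonneg) (auto simp: order.strict_trans1)
    with le e show ?thesis
      by (simp add: nn_integral_eq_integral)
  qed
  obtain N1 where N1: "\<forall>m\<ge>N1. \<forall>n\<ge>N1. (\<integral>\<omega>. (X m \<omega> - X n \<omega>)\<^sup>2 \<partial>M) < 1"
    using Cauchy[of 1] by auto
  have "square_integrable M (\<lambda>\<omega>. X N1 \<omega> - Y \<omega>)"
    using bound[OF zero_less_one N1 order_refl] by (simp add: square_integrable_def)
  from square_integrable_diff[OF X[of N1] this] have Y: "square_integrable M Y"
    by simp
  have "(\<lambda>n. \<integral>\<omega>. (X n \<omega> - Y \<omega>)\<^sup>2 \<partial>M) \<longlonglongrightarrow> 0"
  proof (rule LIMSEQ_I)
    fix e :: real assume e: "e > 0"
    obtain N where N: "\<forall>m\<ge>N. \<forall>n\<ge>N. (\<integral>\<omega>. (X m \<omega> - X n \<omega>)\<^sup>2 \<partial>M) < e / 2"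
      using Cauchy[of "e / 2"] e by auto
    then show "\<exists>N. \<forall>n\<ge>N. norm ((\<integral>\<omega>. (X n \<omega> - Y \<omega>)\<^sup>2 \<partial>M) - 0) < e"
      using bound[of "e / 2" N] e by (intro exI[of _ N]) force
  qed
  with Y show ?thesis by (rule that)
qed

section \<open>Directional derivatives of smooth functions\<close>

text \<open>Both signs of \<open>t\<close> are covered, because difference quotients are taken on both sides of 0.\<close>

lemma mean_value_at_0:
  fixes f :: "real \<Rightarrow> real"
  assumes "\<And>t. (f has_real_derivative f' t) (at t)"
  shows "\<exists>\<theta>. \<bar>\<theta>\<bar> \<le> \<bar>t\<bar> \<and> f t - f 0 = t * f' \<theta>"
proof (cases t "0 :: real" rule: linorder_cases)
  case less
  from MVT2[OF this, of f f'] assms obtain \<theta>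
    where "t < \<theta>" "\<theta> < 0" "f 0 - f t = (0 - t) * f' \<theta>" by blast
  then show ?thesis by (intro exI[of _ \<theta>]) auto
next
  case greater
  from MVT2[OF this, of f f'] assms obtain \<theta>
    where "0 < \<theta>" "\<theta> < t" "f t - f 0 = (t - 0) * f' \<theta>" by blast
  then show ?thesis by (intro exI[of _ \<theta>]) auto
qed auto

text \<open>The mean value theorem, applied in the first variable and then in the second, writes the quotient as
  \<open>c \<theta> \<eta>\<close> with \<open>\<bar>\<theta>\<bar> \<le> \<bar>t\<bar>\<close> and \<open>\<bar>\<eta>\<bar> \<le> \<bar>s\<bar>\<close>. The limit is taken over independent \<open>t\<close> and \<open>s\<close>, since
  comparing two difference quotients of a field involves two increments.\<close>

lemma mixed_difference_quotient_tendsto: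
  fixes k a c :: "real \<Rightarrow> real \<Rightarrow> real"
  assumes k: "\<And>t s. ((\<lambda>t. k t s) has_real_derivative a t s) (at t)"
    and a: "\<And>t s. (a t has_real_derivative c t s) (at s)"
    and c: "isCont (\<lambda>p. c (fst p) (snd p)) (0, 0)"
  shows "((\<lambda>(t, s). (k t s - k t 0 - k 0 s + k 0 0) / (t * s)) \<longlongrightarrow> c 0 0) (at 0 \<times>\<^sub>F at 0)"
proof (rule tendstoI)
  fix e :: real assume e: "e > 0"
  obtain d where d: "d > 0"
    and dc: "\<And>p. dist p (0, 0) < d \<Longrightarrow> dist (c (fst p) (snd p)) (c 0 0) < e"
    using c e unfolding continuous_at_eps_delta by fastforce
  have *: "dist ((k t s - k t 0 - k 0 s + k 0 0) / (t * s)) (c 0 0) < e"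
    if t: "t \<noteq> 0" "\<bar>t\<bar> < d / 2" and s: "s \<noteq> 0" "\<bar>s\<bar> < d / 2" for t s
  proof -
    have "((\<lambda>t. k t s - k t 0) has_real_derivative a t s - a t 0) (at t)" for t
      by (intro DERIV_diff k)
    from mean_value_at_0[of "\<lambda>t. k t s - k t 0", OF this, of t]
    obtain \<theta> where \<theta>: "\<bar>\<theta>\<bar> \<le> \<bar>t\<bar>" "k t s - k t 0 - (k 0 s - k 0 0) = t * (a \<theta> s - a \<theta> 0)"
      by blast
    from mean_value_at_0[of "a \<theta>", OF a, of s]
    obtain \<eta> where \<eta>: "\<bar>\<eta>\<bar> \<le> \<bar>s\<bar>" "a \<theta> s - a \<theta> 0 = s * c \<theta> \<eta>"
      by blast
    have "k t s - k t 0 - k 0 s + k 0 0 = (t * s) * c \<theta> \<eta>"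
      using \<theta>(2) \<eta>(2) by (simp add: algebra_simps)
    moreover have "dist (\<theta>, \<eta>) (0, 0) < d"
      using \<theta>(1) \<eta>(1) t s sqrt_sum_squares_le_sum_abs[of \<theta> \<eta>] by (simp add: dist_Pair_Pair)
    ultimately show ?thesis
      using dc[of "(\<theta>, \<eta>)"] t s by simp
  qed
  have "eventually (\<lambda>t. t \<noteq> 0 \<and> \<bar>t\<bar> < d / 2) (at (0 :: real))"
    unfolding eventually_at using d by (intro exI[of _ "d / 2"]) (auto simp: dist_real_def)
  then show "eventually (\<lambda>x. dist (case x of (t, s) \<Rightarrow> (k t s - k t 0 - k 0 s + k 0 0) / (t * s))
      (c 0 0) < e) (at 0 \<times>\<^sub>F at 0)"
    unfolding eventually_prod_same using * by (intro exI conjI) auto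
qed

lemma cont_diff_imp_continuous_on: "cont_diff k G \<Longrightarrow> continuous_on UNIV G"
  by (cases k) (auto simp: differentiable_imp_continuous_on differentiable_on_def)

lemma cont_diff_directional_derivative:
  assumes "cont_diff (Suc k) G"
  shows "((\<lambda>t. G (p + t *\<^sub>R v)) has_real_derivative
    frechet_derivative G (at (p + t *\<^sub>R v)) v) (at t)"
proof -
  have G: "(G has_derivative frechet_derivative G (at (p + t *\<^sub>R v))) (at (p + t *\<^sub>R v))"
    using assms by (subst frechet_derivative_works[symmetric]) simp
  have "((\<lambda>t. p + t *\<^sub>R v) has_derivative (\<lambda>s. s *\<^sub>R v)) (at t)"
    by (auto intro!: derivative_eq_intros)
  then have "((\<lambda>t. G (p + t *\<^sub>R v)) has_derivative
      (\<lambda>s. frechet_derivative G (at (p + t *\<^sub>R v)) (s *\<^sub>R v))) (at t)"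
    by (rule has_derivative_compose) (rule G)
  moreover have "frechet_derivative G (at (p + t *\<^sub>R v)) (s *\<^sub>R v)
      = frechet_derivative G (at (p + t *\<^sub>R v)) v * s" for s
    using linear_cmul[OF linear_frechet_derivative[of G "at (p + t *\<^sub>R v)"], of s v] assms
    by simp
  ultimately show ?thesis
    by (simp add: has_field_derivative_def)
qed

section \<open>Existence of mean-square derivatives\<close>

lemma has_ms_derivativeD:
  assumes "has_ms_derivative M F b x Y"
  shows "square_integrable M (F y)" "square_integrable M Y"
    "((\<lambda>t. \<integral>\<omega>. ((F (x + t *\<^sub>R b) \<omega> - F x \<omega>) / t - Y \<omega>)\<^sup>2 \<partial>M) \<longlongrightarrow> 0) (at 0)"
  using assms by (auto simp: has_ms_derivative_def)

lemma has_ms_derivative_ms_derivativeI: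
  "has_ms_derivative M F b x Y \<Longrightarrow> has_ms_derivative M F b x (ms_derivative M b F x)"
  unfolding ms_derivative_def by (rule someI[of "has_ms_derivative M F b x"])

text \<open>Covariances with a fixed variable may be differentiated under the expectation; with the constant 1
  as the fixed variable, so may means.\<close>

lemma has_ms_derivative_tendsto_inner:
  assumes D: "has_ms_derivative M F b x Y" and Z: "square_integrable M Z"
  shows "((\<lambda>t. (L2_inner M (F (x + t *\<^sub>R b)) Z - L2_inner M (F x) Z) / t)
    \<longlongrightarrow> L2_inner M Y Z) (at 0)"
proof -
  define q where "q t \<omega> = inverse t * (F (x + t *\<^sub>R b) \<omega> - F x \<omega>)" for t \<omega>
  have q: "square_integrable M (q t)" for t
    unfolding q_def[abs_def] using D
    by (intro square_integrable_cmult square_integrable_diff) (auto simp: has_ms_derivative_def)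
  have "((\<lambda>t. \<integral>\<omega>. (q t \<omega> - Y \<omega>)\<^sup>2 \<partial>M) \<longlongrightarrow> 0) (at 0)"
    using has_ms_derivativeD(3)[OF D] by (simp add: q_def divide_inverse mult.commute)
  from tendsto_L2_inner[OF q has_ms_derivativeD(2)[OF D] Z this] show ?thesis
    unfolding q_def[abs_def] L2_inner_cmult_left
    by (simp add: L2_inner_diff_left has_ms_derivativeD(1)[OF D] Z divide_inverse mult.commute)
qed

text \<open>Write \<open>q t\<close> for the difference quotient with increment \<open>t\<close>. The assumption says that
  \<open>\<langle>q t, q s\<rangle>\<close> tends to \<open>l\<close> for independent \<open>t\<close> and \<open>s\<close>, so that
  \<open>\<parallel>q t - q s\<parallel>\<^sup>2 = \<langle>q t, q t\<rangle> - 2 \<langle>q t, q s\<rangle> + \<langle>q s, q s\<rangle>\<close> tends to \<open>l - 2 l + l = 0\<close>.\<close>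

lemma (in prob_space) has_ms_derivative_exists:
  fixes F :: "'p::real_vector \<Rightarrow> 'a \<Rightarrow> real"
  assumes F: "\<And>y. square_integrable M (F y)"
    and lim: "((\<lambda>(t, s). (L2_inner M (F (x + t *\<^sub>R b)) (F (x + s *\<^sub>R b))
        - L2_inner M (F (x + t *\<^sub>R b)) (F x) - L2_inner M (F x) (F (x + s *\<^sub>R b))
        + L2_inner M (F x) (F x)) / (t * s)) \<longlongrightarrow> l) (at 0 \<times>\<^sub>F at 0)"
  shows "\<exists>Y. has_ms_derivative M F b x Y"
proof -
  define q where "q t \<omega> = inverse t * (F (x + t *\<^sub>R b) \<omega> - F x \<omega>)" for t \<omega>
  have q: "square_integrable M (q t)" for t
    unfolding q_def[abs_def] using F by (intro square_integrable_cmult square_integrable_diff)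
  have inner_q: "L2_inner M (q t) (q s) = (L2_inner M (F (x + t *\<^sub>R b)) (F (x + s *\<^sub>R b))
        - L2_inner M (F (x + t *\<^sub>R b)) (F x) - L2_inner M (F x) (F (x + s *\<^sub>R b))
        + L2_inner M (F x) (F x)) / (t * s)" for t s
    unfolding q_def[abs_def] L2_inner_cmult_left L2_inner_cmult_right
    by (simp add: L2_inner_diff_left L2_inner_diff_right square_integrable_diff F field_simps)
  have near: "\<exists>d>0. \<forall>t s. t \<noteq> 0 \<and> \<bar>t\<bar> < d \<and> s \<noteq> 0 \<and> \<bar>s\<bar> < d \<longrightarrow>
      (\<integral>\<omega>. (q t \<omega> - q s \<omega>)\<^sup>2 \<partial>M) < e" if e: "e > 0" for e
  proof -
    have "eventually (\<lambda>(t, s). \<bar>L2_inner M (q t) (q s) - l\<bar> < e / 4) (at 0 \<times>\<^sub>F at 0)"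
      using tendstoD[OF lim, of "e / 4"] e
      by (simp add: inner_q dist_real_def case_prod_unfold)
    then obtain P where P: "eventually P (at 0)"
      and Pq: "\<And>t s. P t \<Longrightarrow> P s \<Longrightarrow> \<bar>L2_inner M (q t) (q s) - l\<bar> < e / 4"
      unfolding eventually_prod_same by fastforce
    from P obtain d where d: "d > 0" "\<And>t. t \<noteq> 0 \<Longrightarrow> \<bar>t\<bar> < d \<Longrightarrow> P t"
      unfolding eventually_at by (auto simp: dist_real_def)
    \<comment> \<open>Of the four errors \<open>e / 4\<close>, the inner product of \<open>q t\<close> and \<open>q s\<close> accounts for two.\<close>
    have "(\<integral>\<omega>. (q t \<omega> - q s \<omega>)\<^sup>2 \<partial>M) < e"
      if "t \<noteq> 0" "\<bar>t\<bar> < d" "s \<noteq> 0" "\<bar>s\<bar> < d" for t s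
      using Pq[of t t] Pq[of t s] Pq[of s s] d(2)[of t] d(2)[of s] that
      unfolding L2_inner_diff_self[OF q q] by linarith
    then show ?thesis using d(1) by blast
  qed
  \<comment> \<open>Completeness is used along the increments \<open>1 / (n + 1)\<close>; the bound \<open>near\<close> then transfers the
    limit to all increments.\<close>
  define X where "X n = q (inverse (real (Suc n)))" for n
  have small: "\<exists>N. \<forall>n\<ge>N. inverse (real (Suc n)) < d" if d: "d > 0" for d :: real
  proof -
    obtain N where "inverse (real (Suc N)) < d" using reals_Archimedean[OF d] by auto
    moreover have "inverse (real (Suc n)) \<le> inverse (real (Suc N))" if "n \<ge> N" for n
      using that by (simp add: le_imp_inverse_le)
    ultimately show ?thesis by (meson order.strict_trans1)
  qed
  obtain Y where Y: "square_integrable M Y"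
    and XY: "(\<lambda>n. \<integral>\<omega>. (X n \<omega> - Y \<omega>)\<^sup>2 \<partial>M) \<longlonglongrightarrow> 0"
  proof (rule L2_complete[of X])
    fix e :: real assume "e > 0"
    from near[OF this] obtain d where d: "d > 0"
      "\<And>t s. t \<noteq> 0 \<Longrightarrow> \<bar>t\<bar> < d \<Longrightarrow> s \<noteq> 0 \<Longrightarrow> \<bar>s\<bar> < d \<Longrightarrow> (\<integral>\<omega>. (q t \<omega> - q s \<omega>)\<^sup>2 \<partial>M) < e"
      by blast
    obtain N where N: "\<And>n. n \<ge> N \<Longrightarrow> inverse (real (Suc n)) < d"
      using small[OF d(1)] by blast
    show "\<exists>N. \<forall>m\<ge>N. \<forall>n\<ge>N. (\<integral>\<omega>. (X m \<omega> - X n \<omega>)\<^sup>2 \<partial>M) < e"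
      unfolding X_def using N by (intro exI[of _ N] allI impI d(2)) auto
  qed (auto simp: X_def q)
  have "((\<lambda>t. \<integral>\<omega>. (q t \<omega> - Y \<omega>)\<^sup>2 \<partial>M) \<longlongrightarrow> 0) (at 0)"
  proof (rule tendstoI)
    fix e :: real assume e: "e > 0"
    then have "e / 4 > 0" by simp
    from near[OF this] obtain d where d: "d > 0"
      "\<And>t s. t \<noteq> 0 \<Longrightarrow> \<bar>t\<bar> < d \<Longrightarrow> s \<noteq> 0 \<Longrightarrow> \<bar>s\<bar> < d \<Longrightarrow> (\<integral>\<omega>. (q t \<omega> - q s \<omega>)\<^sup>2 \<partial>M) < e / 4"
      by blast
    obtain N where N: "\<And>n. n \<ge> N \<Longrightarrow> inverse (real (Suc n)) < d"
      using small[OF d(1)] by blast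
    have "eventually (\<lambda>n. (\<integral>\<omega>. (X n \<omega> - Y \<omega>)\<^sup>2 \<partial>M) < e / 4) sequentially"
      using order_tendstoD(2)[OF XY, of "e / 4"] e by simp
    then obtain n where n: "n \<ge> N" "(\<integral>\<omega>. (X n \<omega> - Y \<omega>)\<^sup>2 \<partial>M) < e / 4"
      unfolding eventually_sequentially by (meson le_cases)
    have "(\<integral>\<omega>. (q t \<omega> - Y \<omega>)\<^sup>2 \<partial>M) < e" if t: "t \<noteq> 0" "\<bar>t\<bar> < d" for t
    proof -
      have comm: "(\<integral>\<omega>. (Y \<omega> - X n \<omega>)\<^sup>2 \<partial>M) = (\<integral>\<omega>. (X n \<omega> - Y \<omega>)\<^sup>2 \<partial>M)"
        by (rule Bochner_Integration.integral_cong) (auto intro: power2_commute)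
      have X: "square_integrable M (X n)" by (simp add: X_def q)
      have "(\<integral>\<omega>. (q t \<omega> - Y \<omega>)\<^sup>2 \<partial>M)
          = (\<integral>\<omega>. ((q t \<omega> - X n \<omega>) - (Y \<omega> - X n \<omega>))\<^sup>2 \<partial>M)"
        by simp
      also have "\<dots>
          \<le> 2 * (\<integral>\<omega>. (q t \<omega> - X n \<omega>)\<^sup>2 \<partial>M) + 2 * (\<integral>\<omega>. (Y \<omega> - X n \<omega>)\<^sup>2 \<partial>M)"
        by (rule integral_square_diff_le[OF square_integrable_diff[OF q X]
              square_integrable_diff[OF Y X]])
      also have "\<dots> < e"
        unfolding comm using n(2) d(2)[OF t, of "inverse (real (Suc n))"] N[OF n(1)] by (simp add: X_def)
      finally show ?thesis .
    qed
    then show "eventually (\<lambda>t. dist (\<integral>\<omega>. (q t \<omega> - Y \<omega>)\<^sup>2 \<partial>M) 0 < e) (at 0)"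
      unfolding eventually_at using d(1) by (intro exI[of _ d]) (auto simp: dist_real_def)
  qed
  then have "has_ms_derivative M F b x Y"
    using F Y by (simp add: has_ms_derivative_def q_def divide_inverse mult.commute)
  then show ?thesis by blast
qed

text \<open>One differentiation of the field costs two derivatives of its covariance, one in each argument.
  The second claim allows the first one to be applied to the derivative field in turn.\<close>

lemma (in prob_space) cont_diff_covariance_imp_ms_derivative:
  fixes F :: "'p::euclidean_space \<Rightarrow> 'a \<Rightarrow> real"
  assumes F: "\<And>y. square_integrable M (F y)"
    and K: "cont_diff (Suc (Suc k)) (\<lambda>(x, y). L2_inner M (F x) (F y))"
    and b: "b \<in> Basis"
  shows has_ms_derivative_ms_derivative: "has_ms_derivative M F b x (ms_derivative M b F x)"
    and cont_diff_covariance_ms_derivative: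
      "cont_diff k (\<lambda>(x, y). L2_inner M (ms_derivative M b F x) (ms_derivative M b F y))"
proof -
  let ?K = "\<lambda>(x, y). L2_inner M (F x) (F y)"
  define A where "A p = frechet_derivative ?K (at p) (b, 0)" for p
  define B where "B p = frechet_derivative A (at p) (0, b)" for p
  have A: "cont_diff (Suc k) A"
    using K b unfolding A_def[abs_def] cont_diff.simps(2)[of "Suc k"] by (simp add: Basis_prod_def)
  have B: "cont_diff k B"
    using A b unfolding B_def[abs_def] cont_diff.simps(2)[of k] by (simp add: Basis_prod_def)
  have dK: "((\<lambda>t. L2_inner M (F (x + t *\<^sub>R b)) (F y)) has_real_derivative A (x + t *\<^sub>R b, y)) (at t)"
    for x y t
    using cont_diff_directional_derivative[OF K, of "(x, y)" "(b, 0)" t] by (simp add: A_def)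
  have dA: "((\<lambda>s. A (x, y + s *\<^sub>R b)) has_real_derivative B (x, y + s *\<^sub>R b)) (at s)" for x y s
    using cont_diff_directional_derivative[OF A, of "(x, y)" "(0, b)" s] by (simp add: B_def)
  have cB: "isCont B p" for p
    using cont_diff_imp_continuous_on[OF B] by (cases p) (simp add: continuous_on_eq_continuous_at)
  have ex: "\<exists>Y. has_ms_derivative M F b x Y" for x
  proof (rule has_ms_derivative_exists[OF F])
    have "isCont (\<lambda>p. B (x + fst p *\<^sub>R b, x + snd p *\<^sub>R b)) (0, 0)"
      by (intro isCont_o2[OF _ cB] continuous_intros)
    from mixed_difference_quotient_tendsto[of "\<lambda>t s. L2_inner M (F (x + t *\<^sub>R b)) (F (x + s *\<^sub>R b))",
        OF dK dA this]
    show "((\<lambda>(t, s). (L2_inner M (F (x + t *\<^sub>R b)) (F (x + s *\<^sub>R b))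
        - L2_inner M (F (x + t *\<^sub>R b)) (F x) - L2_inner M (F x) (F (x + s *\<^sub>R b))
        + L2_inner M (F x) (F x)) / (t * s)) \<longlongrightarrow> B (x, x)) (at 0 \<times>\<^sub>F at 0)"
      by simp
  qed
  let ?D = "ms_derivative M b F"
  have D: "has_ms_derivative M F b x (?D x)" for x
    using ex[of x] has_ms_derivative_ms_derivativeI by blast
  then show "has_ms_derivative M F b x (?D x)" .
  \<comment> \<open>The covariance is differentiated in its first argument and then in its second.\<close>
  have DF: "L2_inner M (?D x) (F y) = A (x, y)" for x y
  proof (rule LIM_unique)
    have "((\<lambda>t. L2_inner M (F (x + t *\<^sub>R b)) (F y)) has_real_derivative A (x, y)) (at 0)"
      using dK[of x y 0] by simp
    then show "((\<lambda>t. (L2_inner M (F (x + t *\<^sub>R b)) (F y) - L2_inner M (F x) (F y)) / t)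
        \<longlongrightarrow> A (x, y)) (at 0)"
      by (simp add: DERIV_def)
  qed (rule has_ms_derivative_tendsto_inner[OF D F])
  have "L2_inner M (?D x) (?D y) = B (x, y)" for x y
  proof (rule LIM_unique)
    have "((\<lambda>s. A (x, y + s *\<^sub>R b)) has_real_derivative B (x, y)) (at 0)"
      using dA[of x y 0] by simp
    then show "((\<lambda>s. (L2_inner M (F (y + s *\<^sub>R b)) (?D x) - L2_inner M (F y) (?D x)) / s)
        \<longlongrightarrow> B (x, y)) (at 0)"
      by (simp add: DERIV_def L2_inner_commute[of M _ "?D x"] DF)
    show "((\<lambda>s. (L2_inner M (F (y + s *\<^sub>R b)) (?D x) - L2_inner M (F y) (?D x)) / s)
        \<longlongrightarrow> L2_inner M (?D x) (?D y)) (at 0)"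
      unfolding L2_inner_commute[of M "?D x" "?D y"]
      by (rule has_ms_derivative_tendsto_inner[OF D has_ms_derivativeD(2)[OF D]])
  qed
  then show "cont_diff k (\<lambda>(x, y). L2_inner M (?D x) (?D y))"
    using B by (simp add: case_prod_unfold)
qed

lemma (in prob_space) has_ms_derivative_mean_zero:
  assumes D: "has_ms_derivative M F b x Y" and F: "\<And>y. (\<integral>\<omega>. F y \<omega> \<partial>M) = 0"
  shows "(\<integral>\<omega>. Y \<omega> \<partial>M) = 0"
  using has_ms_derivative_tendsto_inner[OF D square_integrable_const[of 1]]
  by (simp add: L2_inner_def F tendsto_const_iff)

section \<open>Rules for mean-square derivatives\<close>

lemma has_ms_derivative_diff:
  assumes D: "has_ms_derivative M F b x Y" and E: "has_ms_derivative M G b x Z"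
  shows "has_ms_derivative M (\<lambda>x \<omega>. F x \<omega> - G x \<omega>) b x (\<lambda>\<omega>. Y \<omega> - Z \<omega>)"
proof -
  let ?p = "\<lambda>t \<omega>. (F (x + t *\<^sub>R b) \<omega> - F x \<omega>) / t - Y \<omega>"
  let ?q = "\<lambda>t \<omega>. (G (x + t *\<^sub>R b) \<omega> - G x \<omega>) / t - Z \<omega>"
  let ?r = "\<lambda>t \<omega>. ((F (x + t *\<^sub>R b) \<omega> - G (x + t *\<^sub>R b) \<omega>) - (F x \<omega> - G x \<omega>)) / t - (Y \<omega> - Z \<omega>)"
  note F = has_ms_derivativeD[OF D] and G = has_ms_derivativeD[OF E]
  have p: "square_integrable M (?p t)" for t
    using square_integrable_diff[OF square_integrable_cmult[OF
          square_integrable_diff[OF F(1) F(1)], of "inverse t"] F(2)]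
    by (simp add: divide_inverse mult.commute)
  have q: "square_integrable M (?q t)" for t
    using square_integrable_diff[OF square_integrable_cmult[OF
          square_integrable_diff[OF G(1) G(1)], of "inverse t"] G(2)]
    by (simp add: divide_inverse mult.commute)
  have r: "?r t \<omega> = ?p t \<omega> - ?q t \<omega>" for t \<omega>
    by (simp add: diff_divide_distrib)
  have le: "(\<integral>\<omega>. (?r t \<omega>)\<^sup>2 \<partial>M) \<le> 2 * (\<integral>\<omega>. (?p t \<omega>)\<^sup>2 \<partial>M) + 2 * (\<integral>\<omega>. (?q t \<omega>)\<^sup>2 \<partial>M)" for t
    unfolding r by (rule integral_square_diff_le[OF p q])
  have "((\<lambda>t. 2 * (\<integral>\<omega>. (?p t \<omega>)\<^sup>2 \<partial>M) + 2 * (\<integral>\<omega>. (?q t \<omega>)\<^sup>2 \<partial>M)) \<longlongrightarrow> 2 * 0 + 2 * 0) (at 0)"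
    by (intro tendsto_intros F(3) G(3))
  then have "((\<lambda>t. 2 * (\<integral>\<omega>. (?p t \<omega>)\<^sup>2 \<partial>M) + 2 * (\<integral>\<omega>. (?q t \<omega>)\<^sup>2 \<partial>M)) \<longlongrightarrow> 0) (at 0)"
    by simp
  then have "((\<lambda>t. \<integral>\<omega>. (?r t \<omega>)\<^sup>2 \<partial>M) \<longlongrightarrow> 0) (at 0)"
    by (rule Lim_null_comparison[rotated]) (use le in \<open>auto intro: always_eventually\<close>)
  then show ?thesis
    using F G by (auto simp: has_ms_derivative_def intro!: square_integrable_diff)
qed

lemma has_ms_derivative_swap:
  assumes "has_ms_derivative M F (prod.swap b) (prod.swap x) Y"
  shows "has_ms_derivative M (\<lambda>x. F (prod.swap x)) b x Y"
proof -
  have "prod.swap (x + t *\<^sub>R b) = prod.swap x + t *\<^sub>R prod.swap b" for t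
    by (simp add: prod_eq_iff)
  then show ?thesis using assms by (simp add: has_ms_derivative_def)
qed

text \<open>Needed to iterate: an explicit formula for a derivative agrees with the chosen representative only
  almost surely, at each point separately.\<close>

lemma has_ms_derivative_cong_AE:
  assumes D: "has_ms_derivative M F b x Y"
    and G: "\<And>y. square_integrable M (G y)"
    and FG: "\<And>y. AE \<omega> in M. F y \<omega> = G y \<omega>"
  shows "has_ms_derivative M G b x Y"
proof -
  note F = has_ms_derivativeD[OF D]
  note [measurable] = square_integrable_measurable[OF G] square_integrable_measurable[OF F(1)]
    square_integrable_measurable[OF F(2)]
  have "(\<integral>\<omega>. ((G (x + t *\<^sub>R b) \<omega> - G x \<omega>) / t - Y \<omega>)\<^sup>2 \<partial>M)
      = (\<integral>\<omega>. ((F (x + t *\<^sub>R b) \<omega> - F x \<omega>) / t - Y \<omega>)\<^sup>2 \<partial>M)" for t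
    by (rule integral_cong_AE) (use FG[of x] FG[of "x + t *\<^sub>R b"] in auto)
  then show ?thesis using F G by (simp add: has_ms_derivative_def)
qed

lemma covar_eq_L2_inner:
  assumes "square_integrable M X" "square_integrable M Y"
    and "square_integrable M X'" "square_integrable M Y'"
    and X: "AE \<omega> in M. X \<omega> = X' \<omega>" and Y: "AE \<omega> in M. Y \<omega> = Y' \<omega>"
    and "(\<integral>\<omega>. X' \<omega> \<partial>M) = 0" "(\<integral>\<omega>. Y' \<omega> \<partial>M) = 0"
  shows "covar M X Y = L2_inner M X' Y'"
proof -
  note [measurable] = assms(1-4)[THEN square_integrable_measurable]
  have "(\<integral>\<omega>. X \<omega> \<partial>M) = 0" "(\<integral>\<omega>. Y \<omega> \<partial>M) = 0"
    using integral_cong_AE[OF _ _ X] integral_cong_AE[OF _ _ Y] assms(7,8) by simp_all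
  moreover have "(\<integral>\<omega>. X \<omega> * Y \<omega> \<partial>M) = (\<integral>\<omega>. X' \<omega> * Y' \<omega> \<partial>M)"
    by (rule integral_cong_AE) (use X Y in auto)
  ultimately show ?thesis by (simp add: covar_def L2_inner_def)
qed

lemma covar_ms_derivatives:
  assumes D: "has_ms_derivative M F b x X'" and E: "has_ms_derivative M G c y Y'"
    and "(\<integral>\<omega>. X' \<omega> \<partial>M) = 0" "(\<integral>\<omega>. Y' \<omega> \<partial>M) = 0"
  shows "covar M (ms_derivative M b F x) (ms_derivative M c G y) = L2_inner M X' Y'"
proof -
  note D' = has_ms_derivative_ms_derivativeI[OF D] and E' = has_ms_derivative_ms_derivativeI[OF E]
  show ?thesis
    by (intro covar_eq_L2_inner has_ms_derivative_unique[OF D' D] has_ms_derivative_unique[OF E' E]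
        D[THEN has_ms_derivativeD(2)] E[THEN has_ms_derivativeD(2)]
        D'[THEN has_ms_derivativeD(2)] E'[THEN has_ms_derivativeD(2)] assms)
qed

lemma (in prob_space) gaussian_rv_square_integrable:
  assumes "gaussian_rv M X"
  shows "square_integrable M X"
proof -
  have [measurable]: "X \<in> borel_measurable M" using assms by (simp add: gaussian_rv_def)
  consider (normal) \<mu> \<sigma> where "\<sigma> > 0" "distributed M lborel X (normal_density \<mu> \<sigma>)"
    | (const) \<mu> where "AE \<omega> in M. X \<omega> = \<mu>"
    using assms by (auto simp: gaussian_rv_def)
  then show ?thesis
  proof cases
    case normal
    have m: "integrable lborel (\<lambda>x. normal_density \<mu> \<sigma> x * (x - \<mu>) ^ 2)"
      using normal(1) by (rule integrable_normal_moment)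
    have "integrable M (\<lambda>\<omega>. (X \<omega> - \<mu>)\<^sup>2)"
      by (rule distributed_integrable[OF normal(2), THEN iffD1, OF _ _ m]) auto
    then have "square_integrable M (\<lambda>\<omega>. X \<omega> - \<mu>)" by (simp add: square_integrable_def)
    from square_integrable_diff[OF this square_integrable_const[of "-\<mu>"]] show ?thesis by simp
  next
    case const
    have "integrable M (\<lambda>\<omega>. (X \<omega>)\<^sup>2) \<longleftrightarrow> integrable M (\<lambda>\<omega>. \<mu>\<^sup>2)"
      by (rule integrable_cong_AE) (use const in auto)
    then show ?thesis by (simp add: square_integrable_def)
  qed
qed

section \<open>Reflections and the parity of covariances\<close>

text \<open>The pair \<open>F, G\<close> is even or odd under \<open>T\<close> for \<open>c = 1\<close> and \<open>c = -1\<close>.\<close>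

definition covariance_parity ::
    "'w measure \<Rightarrow> ('p \<Rightarrow> 'p) \<Rightarrow> real \<Rightarrow> ('p \<Rightarrow> 'w \<Rightarrow> real) \<Rightarrow> ('p \<Rightarrow> 'w \<Rightarrow> real) \<Rightarrow> bool" where
  "covariance_parity M T c F G \<longleftrightarrow>
    (\<forall>x y. L2_inner M (F x) (G y) = c * L2_inner M (F (T x)) (G (T y)))"

lemma covariance_parity_commute: "covariance_parity M T c F G \<Longrightarrow> covariance_parity M T c G F"
  unfolding covariance_parity_def by (subst (1 2) L2_inner_commute) blast

lemma covariance_parity_fixed_point:
  assumes FG: "covariance_parity M T (- 1) F G" and z: "T z = z"
  shows "L2_inner M (F z) (G z) = 0"
proof -
  have "L2_inner M (F z) (G z) = - 1 * L2_inner M (F (T z)) (G (T z))"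
    using FG unfolding covariance_parity_def by blast
  then show ?thesis unfolding z by linarith
qed

text \<open>If \<open>T\<close> multiplies increments in direction \<open>b\<close> by the sign \<open>s\<close>, then the difference quotient of \<open>F\<close>
  at \<open>x\<close> with increment \<open>t\<close> corresponds to \<open>s\<close> times the one at \<open>T x\<close> with increment \<open>s t\<close>.\<close>

lemma covariance_parity_ms_derivative:
  fixes T :: "'p::real_vector \<Rightarrow> 'p"
  assumes D: "\<And>x. has_ms_derivative M F b x (D x)"
    and G: "\<And>y. square_integrable M (G y)"
    and FG: "covariance_parity M T c F G"
    and T: "\<And>x t. T (x + t *\<^sub>R b) = T x + (s * t) *\<^sub>R b"
    and s: "s\<^sup>2 = 1"
  shows "covariance_parity M T (s * c) D G"
  unfolding covariance_parity_def
proof (intro allI)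
  fix x y
  define \<psi> where "\<psi> t = (L2_inner M (F (T x + t *\<^sub>R b)) (G (T y)) - L2_inner M (F (T x)) (G (T y))) / t"
    for t
  have s0: "s = 1 \<or> s = -1" using s by (simp add: power2_eq_1_iff)
  then have st: "filterlim (\<lambda>t. s * t) (at 0) (at 0)"
    by (auto simp: filterlim_at eventually_at_filter intro!: tendsto_eq_intros)
  have "(\<psi> \<longlongrightarrow> L2_inner M (D (T x)) (G (T y))) (at 0)"
    unfolding \<psi>_def[abs_def] by (rule has_ms_derivative_tendsto_inner[OF D G])
  from tendsto_mult_left[OF filterlim_compose[OF this st], of "s * c"]
  have lim: "((\<lambda>t. s * c * \<psi> (s * t)) \<longlongrightarrow> s * c * L2_inner M (D (T x)) (G (T y))) (at 0)" .
  have eq: "L2_inner M (F x) (G y) = c * L2_inner M (F (T x)) (G (T y))" for x y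
    using FG unfolding covariance_parity_def by blast
  have "(L2_inner M (F (x + t *\<^sub>R b)) (G y) - L2_inner M (F x) (G y)) / t = s * c * \<psi> (s * t)" for t
    using s0 unfolding eq[of _ y] T \<psi>_def
    by (auto simp: right_diff_distrib diff_divide_distrib)
  then show "L2_inner M (D x) (G y) = s * c * L2_inner M (D (T x)) (G (T y))"
    using has_ms_derivative_tendsto_inner[OF D G, of x y] lim by (auto intro: LIM_unique)
qed

definition reflect_blocks ::
    "real \<Rightarrow> real \<Rightarrow> 'a \<times> 'a \<Rightarrow> ('a::real_vector) \<times> 'a \<Rightarrow> 'a \<times> 'a" where
  "reflect_blocks r s z x =
    (fst z + r *\<^sub>R (fst x - fst z), snd z + s *\<^sub>R (snd x - snd z))"

lemma reflect_blocks_center: "reflect_blocks r s z z = z"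
  by (simp add: reflect_blocks_def)

lemma norm_reflect_blocks:
  fixes x y z :: "'a::real_normed_vector \<times> 'a"
  assumes "r\<^sup>2 = 1" "s\<^sup>2 = 1"
  shows "norm (reflect_blocks r s z x - reflect_blocks r s z y) = norm (x - y)"
proof -
  have "fst z + r *\<^sub>R (fst x - fst z) - (fst z + r *\<^sub>R (fst y - fst z)) = r *\<^sub>R (fst x - fst y)"
    "snd z + s *\<^sub>R (snd x - snd z) - (snd z + s *\<^sub>R (snd y - snd z)) = s *\<^sub>R (snd x - snd y)"
    by (simp_all add: algebra_simps)
  then show ?thesis
    using assms by (simp add: reflect_blocks_def norm_prod_def power_mult_distrib)
qed

text \<open>Meant for directions \<open>b \<noteq> 0\<close> with \<open>fst b = 0\<close> or \<open>snd b = 0\<close>; on these, \<open>reflect_blocks r s z\<close> acts on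
  increments as multiplication by this number.\<close>

definition block_sign :: "real \<Rightarrow> real \<Rightarrow> ('a \<times> 'a::real_vector) \<Rightarrow> real" where
  "block_sign r s b = (if snd b = 0 then r else s)"

lemma reflect_blocks_shift:
  assumes "fst b = 0 \<or> snd b = 0"
  shows "reflect_blocks r s z (x + t *\<^sub>R b)
    = reflect_blocks r s z x + (block_sign r s b * t) *\<^sub>R b"
  using assms by (auto simp: reflect_blocks_def block_sign_def prod_eq_iff algebra_simps)

lemma swap_Basis:
  "b \<in> Basis \<Longrightarrow> prod.swap b \<in> (Basis :: ('a::euclidean_space \<times> 'a) set)"
  by (auto simp: Basis_prod_def)

lemma block_sign_swap:
  "b \<in> Basis \<Longrightarrow> block_sign 1 (- 1) (prod.swap b) = - block_sign 1 (- 1) b"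
  by (auto simp: Basis_prod_def block_sign_def)

section \<open>Derivatives of a smooth isotropic field\<close>

text \<open>What the symmetry argument uses of an isotropic Gaussian field: centred second-order variables
  whose second moments are a smooth function of the points and depend on their distance only.\<close>

locale smooth_isotropic_field = prob_space M for M :: "'w measure" +
  fixes h :: "real \<Rightarrow> real" and u :: "'a::euclidean_space \<times> 'a \<Rightarrow> 'w \<Rightarrow> real"
  assumes square_integrable_u: "square_integrable M (u x)"
    and mean_u: "(\<integral>\<omega>. u x \<omega> \<partial>M) = 0"
    and inner_u: "L2_inner M (u x) (u y) = h ((norm (x - y))\<^sup>2)"
    and smooth_u: "cont_diff 4 (\<lambda>(x, y). L2_inner M (u x) (u y))"
begin

definition "U1 b = ms_derivative M b u"
definition "U2 a b = ms_derivative M a (U1 b)"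

lemma has_ms_derivative_U1:
  assumes b: "b \<in> Basis"
  shows "has_ms_derivative M u b x (U1 b x)"
  using has_ms_derivative_ms_derivative[OF square_integrable_u _ b, of "Suc (Suc 0)"] smooth_u
  by (simp add: U1_def eval_nat_numeral)

lemmas square_integrable_U1 = has_ms_derivativeD(2)[OF has_ms_derivative_U1]

lemma has_ms_derivative_U2:
  assumes a: "a \<in> Basis" and b: "b \<in> Basis"
  shows "has_ms_derivative M (U1 b) a x (U2 a b x)"
proof -
  have "cont_diff (Suc (Suc 0)) (\<lambda>(x, y). L2_inner M (U1 b x) (U1 b y))"
    unfolding U1_def using smooth_u
    by (intro cont_diff_covariance_ms_derivative square_integrable_u b) (simp add: eval_nat_numeral)
  then show ?thesis
    unfolding U2_def by (intro has_ms_derivative_ms_derivative square_integrable_U1 a b)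
qed

lemmas square_integrable_U2 = has_ms_derivativeD(2)[OF has_ms_derivative_U2]

lemma mean_U1: "b \<in> Basis \<Longrightarrow> (\<integral>\<omega>. U1 b x \<omega> \<partial>M) = 0"
  by (rule has_ms_derivative_mean_zero[OF has_ms_derivative_U1 mean_u])

lemma mean_U2: "a \<in> Basis \<Longrightarrow> b \<in> Basis \<Longrightarrow> (\<integral>\<omega>. U2 a b x \<omega> \<partial>M) = 0"
  by (rule has_ms_derivative_mean_zero[OF has_ms_derivative_U2 mean_U1])

context
  fixes r s :: real and z :: "'a \<times> 'a"
  assumes r: "r\<^sup>2 = 1" and s: "s\<^sup>2 = 1"
begin

lemma covariance_parity_derivative:
  assumes b: "b \<in> Basis" and D: "\<And>x. has_ms_derivative M F b x (D x)"
    and G: "\<And>y. square_integrable M (G y)"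
    and FG: "covariance_parity M (reflect_blocks r s z) c F G"
  shows "covariance_parity M (reflect_blocks r s z) (block_sign r s b * c) D G"
proof (rule covariance_parity_ms_derivative[OF D G FG])
  show "reflect_blocks r s z (x + t *\<^sub>R b)
      = reflect_blocks r s z x + (block_sign r s b * t) *\<^sub>R b" for x t
    using b by (intro reflect_blocks_shift) (auto simp: Basis_prod_def)
  show "(block_sign r s b)\<^sup>2 = 1" using r s by (simp add: block_sign_def)
qed

lemma covariance_parity_U1_U1:
  assumes b: "b \<in> Basis" and d: "d \<in> Basis"
  shows "covariance_parity M (reflect_blocks r s z)
    (block_sign r s b * block_sign r s d) (U1 b) (U1 d)"
proof -
  have "covariance_parity M (reflect_blocks r s z) 1 u u"
    by (simp add: covariance_parity_def inner_u norm_reflect_blocks[OF r s])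
  from covariance_parity_derivative[OF d has_ms_derivative_U1[OF d] square_integrable_u this]
  have "covariance_parity M (reflect_blocks r s z) (block_sign r s d) u (U1 d)"
    unfolding mult_1_right by (rule covariance_parity_commute)
  from covariance_parity_derivative[OF b has_ms_derivative_U1[OF b] square_integrable_U1[OF d] this]
  show ?thesis .
qed

lemma covariance_parity_U2_U1:
  assumes a: "a \<in> Basis" and b: "b \<in> Basis" and d: "d \<in> Basis"
  shows "covariance_parity M (reflect_blocks r s z)
    (block_sign r s a * (block_sign r s b * block_sign r s d)) (U2 a b) (U1 d)"
  by (rule covariance_parity_derivative[OF a has_ms_derivative_U2[OF a b]
        square_integrable_U1[OF d] covariance_parity_U1_U1[OF b d]])

lemma covariance_parity_U2_U2:
  assumes a: "a \<in> Basis" and b: "b \<in> Basis" and c: "c \<in> Basis" and d: "d \<in> Basis"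
  shows "covariance_parity M (reflect_blocks r s z)
    (block_sign r s c * (block_sign r s a * (block_sign r s b * block_sign r s d))) (U2 a b) (U2 c d)"
  by (rule covariance_parity_commute[OF covariance_parity_derivative[OF c
          has_ms_derivative_U2[OF c d] square_integrable_U2[OF a b]
          covariance_parity_commute[OF covariance_parity_U2_U1[OF a b d]]]])

end

text \<open>Point reflection: the total sign is \<open>(-1)\<^sup>3\<close>.\<close>

lemma inner_U2_U1_eq_0:
  assumes "a \<in> Basis" "b \<in> Basis" "d \<in> Basis"
  shows "L2_inner M (U2 a b z) (U1 d z) = 0"
proof -
  have "covariance_parity M (reflect_blocks (-1) (-1) z) (-1) (U2 a b) (U1 d)"
    using covariance_parity_U2_U1[of "-1" "-1", OF _ _ assms] by (simp add: block_sign_def)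
  then show ?thesis by (rule covariance_parity_fixed_point[OF _ reflect_blocks_center])
qed

text \<open>Reflection of the second block: the sign condition says that an odd number of the four directions
  lie in the second block.\<close>

lemma inner_U2_U2_eq_0:
  assumes "a \<in> Basis" "b \<in> Basis" "c \<in> Basis" "d \<in> Basis"
    and sign: "block_sign 1 (-1) a * block_sign 1 (-1) b * block_sign 1 (-1) c * block_sign 1 (-1) d = -1"
  shows "L2_inner M (U2 a b z) (U2 c d z) = 0"
proof -
  have "covariance_parity M (reflect_blocks 1 (-1) z) (-1) (U2 a b) (U2 c d)"
    using covariance_parity_U2_U2[of 1 "-1", OF _ _ assms(1-4), of z] sign
    by (simp add: ac_simps)
  then show ?thesis by (rule covariance_parity_fixed_point[OF _ reflect_blocks_center])
qed

section \<open>Derivatives of the block isotropic field\<close>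

lemma has_ms_derivative_block_field:
  assumes b: "b \<in> Basis"
  shows "has_ms_derivative M (block_field u) b x
    (\<lambda>\<omega>. U1 b x \<omega> - U1 (prod.swap b) (prod.swap x) \<omega>)"
  unfolding block_field_def[abs_def]
  by (rule has_ms_derivative_diff[OF has_ms_derivative_U1[OF b]
      has_ms_derivative_swap[where F = u, OF has_ms_derivative_U1[OF swap_Basis[OF b]]]])

lemma has_ms_derivative_block_field_iterated:
  assumes a: "a \<in> Basis" and b: "b \<in> Basis"
  shows "has_ms_derivative M (ms_derivative M b (block_field u)) a x
    (\<lambda>\<omega>. U2 a b x \<omega> - U2 (prod.swap a) (prod.swap b) (prod.swap x) \<omega>)"
proof (rule has_ms_derivative_cong_AE)
  show "has_ms_derivative M (\<lambda>x \<omega>. U1 b x \<omega> - U1 (prod.swap b) (prod.swap x) \<omega>) a x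
      (\<lambda>\<omega>. U2 a b x \<omega> - U2 (prod.swap a) (prod.swap b) (prod.swap x) \<omega>)"
    by (intro has_ms_derivative_diff has_ms_derivative_U2 a b
        has_ms_derivative_swap[where F = "U1 (prod.swap b)"] swap_Basis)
next
  fix y
  note D = has_ms_derivative_block_field[OF b, of y]
  note D' = has_ms_derivative_ms_derivativeI[OF D]
  show "square_integrable M (ms_derivative M b (block_field u) y)"
    by (rule has_ms_derivativeD(2)[OF D'])
  show "AE \<omega> in M. U1 b y \<omega> - U1 (prod.swap b) (prod.swap y) \<omega> = ms_derivative M b (block_field u) y \<omega>"
    by (rule has_ms_derivative_unique[OF D D'])
qed

lemma mean_U1_diff:
  assumes "a \<in> Basis" "b \<in> Basis"
  shows "(\<integral>\<omega>. U1 a x \<omega> - U1 b y \<omega> \<partial>M) = 0"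
  using assms by (simp add: mean_U1 square_integrable_imp_integrable square_integrable_U1)

lemma mean_U2_diff:
  assumes "a \<in> Basis" "b \<in> Basis" "c \<in> Basis" "d \<in> Basis"
  shows "(\<integral>\<omega>. U2 a b x \<omega> - U2 c d y \<omega> \<partial>M) = 0"
  using assms by (simp add: mean_U2 square_integrable_imp_integrable square_integrable_U2)

lemma covar_second_first_block_field:
  assumes a: "a \<in> Basis" and b: "b \<in> Basis" and d: "d \<in> Basis" and z: "prod.swap z = z"
  shows "covar M (ms_derivative M a (ms_derivative M b (block_field u)) z)
    (ms_derivative M d (block_field u) z) = 0"
proof -
  have "covar M (ms_derivative M a (ms_derivative M b (block_field u)) z)
      (ms_derivative M d (block_field u) z)
      = L2_inner M (\<lambda>\<omega>. U2 a b z \<omega> - U2 (prod.swap a) (prod.swap b) (prod.swap z) \<omega>)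
          (\<lambda>\<omega>. U1 d z \<omega> - U1 (prod.swap d) (prod.swap z) \<omega>)"
    by (intro covar_ms_derivatives has_ms_derivative_block_field
        has_ms_derivative_block_field_iterated mean_U1_diff mean_U2_diff swap_Basis a b d)
  also have "\<dots> = 0"
    unfolding z using a b d
    by (simp add: L2_inner_diff_left L2_inner_diff_right square_integrable_diff
        square_integrable_U1 square_integrable_U2 swap_Basis inner_U2_U1_eq_0)
  finally show ?thesis .
qed

text \<open>Expanding both derivatives by bilinearity gives four covariances of second derivatives of \<open>u\<close>.
  Flipping both directions of one derivative reverses two of the four signs, so the sign condition
  holds for each of these covariances.\<close>

lemma covar_second_second_block_field:
  assumes a: "a \<in> Basis" and b: "b \<in> Basis" and c: "c \<in> Basis" and d: "d \<in> Basis"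
    and z: "prod.swap z = z"
    and sign: "block_sign 1 (-1) a * block_sign 1 (-1) b * block_sign 1 (-1) c * block_sign 1 (-1) d = -1"
  shows "covar M (ms_derivative M a (ms_derivative M b (block_field u)) z)
    (ms_derivative M c (ms_derivative M d (block_field u)) z) = 0"
proof -
  have "covar M (ms_derivative M a (ms_derivative M b (block_field u)) z)
      (ms_derivative M c (ms_derivative M d (block_field u)) z)
      = L2_inner M (\<lambda>\<omega>. U2 a b z \<omega> - U2 (prod.swap a) (prod.swap b) (prod.swap z) \<omega>)
          (\<lambda>\<omega>. U2 c d z \<omega> - U2 (prod.swap c) (prod.swap d) (prod.swap z) \<omega>)"
    by (intro covar_ms_derivatives has_ms_derivative_block_field_iterated mean_U2_diff
        swap_Basis a b c d)
  also have "\<dots> = 0"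
    unfolding z using a b c d sign
    by (simp add: L2_inner_diff_left L2_inner_diff_right square_integrable_diff
        square_integrable_U2 swap_Basis inner_U2_U2_eq_0 block_sign_swap)
  finally show ?thesis .
qed

end

section \<open>Uncorrelated derivatives at a flip-invariant point\<close>

lemma (in prob_space) smooth_isotropic_fieldI:
  fixes u :: "'b::euclidean_space \<times> 'b \<Rightarrow> 'a \<Rightarrow> real"
  assumes u: "isotropic_gaussian_field M h u"
    and smooth: "cont_diff 4 (\<lambda>(x, y). covar M (u x) (u y))"
  shows "smooth_isotropic_field M h u"
proof
  have mean: "(\<integral>\<omega>. u x \<omega> \<partial>M) = 0" for x
    using u unfolding isotropic_gaussian_field_def by blast
  have inner: "L2_inner M (u x) (u y) = covar M (u x) (u y)" for x y
    by (simp add: covar_def L2_inner_def mean)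
  fix x y
  show "(\<integral>\<omega>. u x \<omega> \<partial>M) = 0" by (rule mean)
  show "L2_inner M (u x) (u y) = h ((norm (x - y))\<^sup>2)"
    using u unfolding inner isotropic_gaussian_field_def by blast
  show "cont_diff 4 (\<lambda>(x, y). L2_inner M (u x) (u y))"
    using smooth by (simp add: inner)
  have "gaussian_field M u"
    using u unfolding isotropic_gaussian_field_def by (rule conjunct1)
  from this[unfolded gaussian_field_def, rule_format, of "{x}" "\<lambda>_. 1"]
  show "square_integrable M (u x)"
    by (simp add: gaussian_rv_square_integrable)
qed

theorem theorem20:
  fixes M :: "'w measure"
    and h :: "real \<Rightarrow> real"
    and u :: "(real ^ 'n) \<times> (real ^ 'n) \<Rightarrow> 'w \<Rightarrow> real"
    and f :: "(real ^ 'n) \<times> (real ^ 'n) \<Rightarrow> 'w \<Rightarrow> real"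
    and zstar :: "real ^ 'n"
    and z :: "(real ^ 'n) \<times> (real ^ 'n)"
    and g :: "'n \<Rightarrow> 'w \<Rightarrow> real"
    and H11 H12 :: "'n \<Rightarrow> 'n \<Rightarrow> 'w \<Rightarrow> real"
    and i j k l :: 'n
  assumes "prob_space M"
    and "isotropic_gaussian_field M h u"
    and "cont_diff 4 (\<lambda>(x, y). covar M (u x) (u y))"
    and "C2_halfline h"
    and "f = block_field u"
    and "z = (zstar, zstar)"
    and "g = grad1 M f z"
    and "H11 = hess11 M f z"
    and "H12 = hess12 M f z"
  shows "covar M (g i) (f z) = 0 \<and>
         covar M (H11 i j) (f z) = 0 \<and>
         covar M (H12 i j) (f z) = 0 \<and>
         covar M (H11 i j) (g k) = 0 \<and>
         covar M (H12 i j) (g k) = 0 \<and>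
         covar M (H12 i j) (H11 k l) = 0"
proof -
  interpret prob_space M by fact
  interpret smooth_isotropic_field M h u
    by (rule smooth_isotropic_fieldI) fact+
  have f0: "f z = (\<lambda>_. 0)"
    by (simp add: assms(5,6) block_field_def fun_eq_iff)
  have covar_f: "covar M X (f z) = 0" for X
    by (simp add: f0 covar_def)
  have dir: "dir1 i \<in> Basis" "dir2 i \<in> Basis" for i :: 'n
    by (auto simp: Basis_prod_def axis_in_Basis_iff)
  have z: "prod.swap z = z" by (simp add: assms(6))
  have "covar M (H11 i j) (g k) = 0" "covar M (H12 i j) (g k) = 0"
    unfolding assms(5,7-9) grad1_def hess11_def hess12_def
    by (intro covar_second_first_block_field dir z)+
  moreover have "covar M (H12 i j) (H11 k l) = 0"
    unfolding assms(5,8,9) hess11_def hess12_def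
    by (intro covar_second_second_block_field dir z) (simp add: block_sign_def axis_eq_0_iff)
  ultimately show ?thesis
    using covar_f by simp
qed

end
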